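(* Let $R$ be a $*$-ring and let $a,b,c\in R$. Then $a\in R_{lh(b,c)}^{\mathrm{cEP}}$ (i.e. $a$ has a left hybrid core-EP-$(b,c)$-inverse) if and only if both of the following hold: (1) $a$ is Drazin invertible; (2) there exists a projection $p\in R$ such that $a+p$ is invertible in $R$, $1-p\in R_{lh(b,c)}^{\mathrm{core}}$, and $pa=pap$ is nilpotent.
   Context: A $*$-ring is an associative ring with identity with an involution $x\mapsto x^*$ satisfying $(x+y)^*=x^*+y^*$, $(xy)^*=y^*x^*$, $(x^* )^*=x$. A projection is an element $p$ with $p^2=p=p^*$. For $x\in R$, $\ell(x)=\{r\in R: rx=0\}$. An element $a$ is Drazin invertible if there is $z$ with $az=za$, $zaz=z$, $a^{k+1}z=a^k$ for some $k\in\mathbb N$. Core inverse: $a\in R$ is core invertible ($a\in R^{\mathrm{core}}$) if there is $x\in R$ with $ax^2=x$, $(ax)^*=ax$, $xa^2=a$; such $x$ is unique and denoted $a^{\mathrm{core}}$. Left hybrid $(b,c)$-inverse: $a\in R_{lh}^{(b,c)}$ if there is $x\in R$ with $xax=x$, $\ell(x)=\ell(b)$, $Rx=Rc$; such $x$ is unique and denoted $a_{lh}^{(b,c)}$. Left hybrid core-$(b,c)$-inverse: $a\in R_{lh(b,c)}^{\mathrm{core}}$ if $a\in R^{\mathrm{core}}$, $a\in R_{lh}^{(b,c)}$ and $a^{\mathrm{core}}=a_{lh}^{(b,c)}$. Left hybrid core-EP-$(b,c)$-inverse: $a\in R_{lh(b,c)}^{\mathrm{cEP}}$ if there exist $x,y\in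 R$ with $a=x+y$, $x^*y=yx=0$, $x\in R_{lh(b,c)}^{\mathrm{core}}$ and $y$ nilpotent. *)

theory Defs
  imports Main
begin

text \<open>The class \<open>ring + monoid_mult\<close> is used instead of \<open>ring_1\<close> because the latter
  demands \<open>0 \<noteq> 1\<close>, which an associative ring with identity need not satisfy.\<close>

class star_ring = ring + monoid_mult +
  fixes star :: "'a \<Rightarrow> 'a"  (\<open>(_\<^sup>\<star>)\<close> [1000] 999)
  assumes star_add: "(x + y)\<^sup>\<star> = x\<^sup>\<star> + y\<^sup>\<star>"
    and star_mult: "(x * y)\<^sup>\<star> = y\<^sup>\<star> * x\<^sup>\<star>"
    and star_star: "(x\<^sup>\<star>)\<^sup>\<star> = x"

definition projection :: "'a::star_ring \<Rightarrow> bool" where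
  "projection p \<longleftrightarrow> p ^ 2 = p \<and> p = p\<^sup>\<star>"

definition ring_invertible :: "'a::{ring,monoid_mult} \<Rightarrow> bool" where
  "ring_invertible a \<longleftrightarrow> (\<exists>u. a * u = 1 \<and> u * a = 1)"

definition nilpotent :: "'a::{ring,monoid_mult} \<Rightarrow> bool" where
  "nilpotent a \<longleftrightarrow> (\<exists>n. a ^ n = 0)"

definition left_ann :: "'a::{ring,monoid_mult} \<Rightarrow> 'a set" where
  "left_ann x = {r. r * x = 0}"

definition left_principal :: "'a::{ring,monoid_mult} \<Rightarrow> 'a set" where
  "left_principal x = {r * x | r. True}"

definition drazin_invertible :: "'a::{ring,monoid_mult} \<Rightarrow> bool" where
  "drazin_invertible a \<longleftrightarrow>
     (\<exists>z. a * z = z * a \<and> z * a * z = z \<and> (\<exists>k. a ^ (k + 1) * z = a ^ k))"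

definition is_core_inverse :: "'a::star_ring \<Rightarrow> 'a \<Rightarrow> bool" where
  "is_core_inverse a x \<longleftrightarrow> a * x ^ 2 = x \<and> (a * x)\<^sup>\<star> = a * x \<and> x * a ^ 2 = a"

definition core_invertible :: "'a::star_ring \<Rightarrow> bool" where
  "core_invertible a \<longleftrightarrow> (\<exists>x. is_core_inverse a x)"

definition core_inverse :: "'a::star_ring \<Rightarrow> 'a" where
  "core_inverse a = (THE x. is_core_inverse a x)"

definition is_lh_inverse :: "'a::{ring,monoid_mult} \<Rightarrow> 'a \<Rightarrow> 'a \<Rightarrow> 'a \<Rightarrow> bool" where
  "is_lh_inverse b c a x \<longleftrightarrow>
     x * a * x = x \<and> left_ann x = left_ann b \<and> left_principal x = left_principal c"

definition lh_invertible :: "'a::{ring,monoid_mult} \<Rightarrow> 'a \<Rightarrow> 'a \<Rightarrow> bool" where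
  "lh_invertible b c a \<longleftrightarrow> (\<exists>x. is_lh_inverse b c a x)"

definition lh_inverse :: "'a::{ring,monoid_mult} \<Rightarrow> 'a \<Rightarrow> 'a \<Rightarrow> 'a" where
  "lh_inverse b c a = (THE x. is_lh_inverse b c a x)"

definition lh_core_invertible :: "'a::star_ring \<Rightarrow> 'a \<Rightarrow> 'a \<Rightarrow> bool" where
  "lh_core_invertible b c a \<longleftrightarrow>
     core_invertible a \<and> lh_invertible b c a \<and> core_inverse a = lh_inverse b c a"

definition lh_core_EP_invertible :: "'a::star_ring \<Rightarrow> 'a \<Rightarrow> 'a \<Rightarrow> bool" where
  "lh_core_EP_invertible b c a \<longleftrightarrow>
     (\<exists>x y. a = x + y \<and> x\<^sup>\<star> * y = 0 \<and> y * x = 0 \<and> lh_core_invertible b c x \<and> nilpotent y)"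

text \<open>Both kinds of inverse are unique, so the definite descriptions above are meaningful
  whenever the inverse exists.\<close>

lemma is_core_inverse_unique:
  assumes "is_core_inverse a x" "is_core_inverse a y"
  shows "x = y"
proof -
  have x: "a * (x * x) = x" "(a * x)\<^sup>\<star> = a * x" "x * (a * a) = a"
    and y: "a * (y * y) = y" "(a * y)\<^sup>\<star> = a * y" "y * (a * a) = a"
    using assms by (auto simp: is_core_inverse_def power2_eq_square)
  have inner: "a * z * a = a" if "a * (z * z) = z" "z * (a * a) = a" for z
    using that by (metis mult.assoc)
  have absorb: "x * a * z = z" if "a * (z * z) = z" for z
    using that x(3) by (metis mult.assoc)
  have "a * x = a * y * (a * x)"
    using inner[OF y(1,3)] by (metis mult.assoc)
  then have "a * x = (a * x) * (a * y)"
    using x(2) y(2) by (metis star_mult)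
  also have "\<dots> = a * y"
    using inner[OF x(1,3)] by (metis mult.assoc)
  finally have "a * x = a * y" .
  then show ?thesis
    using absorb[OF x(1)] absorb[OF y(1)] by (metis mult.assoc)
qed

lemma is_lh_inverse_unique:
  assumes "is_lh_inverse b c a x" "is_lh_inverse b c a y"
  shows "x = y"
proof -
  have x: "x * a * x = x" and y: "y * a * y = y"
    and ann: "left_ann x = left_ann y" and gen: "left_principal x = left_principal y"
    using assms by (auto simp: is_lh_inverse_def)
  have "1 - x * a \<in> left_ann x"
    using x by (simp add: left_ann_def left_diff_distrib)
  then have "1 - x * a \<in> left_ann y"
    using ann by simp
  then have "x * a * y = y"
    by (simp add: left_ann_def left_diff_distrib)
  moreover have "x \<in> left_principal x"
    unfolding left_principal_def by (metis (mono_tags, lifting) mem_Collect_eq mult_1_left)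
  then obtain t where "x = t * y"
    using gen by (auto simp: left_principal_def)
  then have "x * a * y = x"
    using y by (metis mult.assoc)
  ultimately show ?thesis by simp
qed

end

theory Submission
  imports Defs
begin

text \<open>The core inverse \<open>x'\<close> of \<open>x\<close> satisfies \<open>\<ell>(x') = \<ell>(x)\<close> and \<open>R x' = R x\<^sup>\<star>\<close>, so being left
  hybrid core-\<open>(b,c)\<close>-invertible depends on a core invertible \<open>x\<close> only through these two sets,
  which \<open>x\<close> shares with the projection \<open>x x'\<close>.
  Given a decomposition \<open>a = x + y\<close>, put \<open>p = 1 - x x'\<close>: then \<open>p a = y\<close>, and
  \<open>a + p = (1 + y)(x + 1 - x x')\<close> is a product of two units.
  Conversely, put \<open>e = 1 - p\<close>, \<open>x = e a\<close> and \<open>y = p a\<close>. Relative to \<open>e\<close> and \<open>p\<close>, the unit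
  \<open>a + p\<close> is upper triangular and its lower diagonal entry \<open>p + y\<close> is invertible, hence so is the upper
  one, \<open>e a e\<close>; the inverse of the latter in \<open>e R e\<close> is the core inverse of \<open>x\<close>.\<close>

section \<open>Reduction of the hybrid condition to annihilators and left ideals\<close>

lemma is_core_inverseD:
  assumes "is_core_inverse a x"
  shows "a * (x * x) = x" "(a * x)\<^sup>\<star> = a * x" "x * (a * a) = a"
    "a * x * a = a" "x * a * x = x"
proof -
  show *: "a * (x * x) = x" "(a * x)\<^sup>\<star> = a * x" "x * (a * a) = a"
    using assms by (auto simp: is_core_inverse_def power2_eq_square)
  show "a * x * a = a" "x * a * x = x"
    using *(1,3) by (metis mult.assoc)+
qed

lemma core_inverse_eqI: "is_core_inverse a x \<Longrightarrow> core_inverse a = x"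
  unfolding core_inverse_def by (blast intro: is_core_inverse_unique)

lemma lh_inverse_eqI: "is_lh_inverse b c a x \<Longrightarrow> lh_inverse b c a = x"
  unfolding lh_inverse_def by (blast intro: is_lh_inverse_unique)

lemma left_ann_eqI:
  assumes "x = y * s" "y = x * t"
  shows "left_ann x = left_ann y"
  unfolding left_ann_def using assms by (metis mult.assoc mult_zero_left)

lemma left_principal_eqI:
  assumes "x = s * y" "y = t * x"
  shows "left_principal x = left_principal y"
  unfolding left_principal_def using assms by (metis mult.assoc)

lemma lh_core_invertible_iff_is_lh_inverse:
  assumes "is_core_inverse a x"
  shows "lh_core_invertible b c a \<longleftrightarrow> is_lh_inverse b c a x"
  using assms core_inverse_eqI lh_inverse_eqI
  unfolding lh_core_invertible_def lh_invertible_def core_invertible_def by metis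

lemma lh_core_invertible_iff:
  assumes "is_core_inverse a x"
  shows "lh_core_invertible b c a \<longleftrightarrow>
    left_ann a = left_ann b \<and> left_principal (a\<^sup>\<star>) = left_principal c"
proof -
  note x = is_core_inverseD[OF assms]
  have "left_ann x = left_ann a"
    using x(1,3) by (metis left_ann_eqI)
  moreover have "left_principal x = left_principal (a\<^sup>\<star>)"
  proof (rule left_principal_eqI)
    \<comment> \<open>Both factorizations replace \<open>a * x\<close> by its adjoint, in
      \<open>x = x * (a * x)\<close> here and in the adjoint of \<open>a = a * x * a\<close>
      below.\<close>
    show "x = x * x\<^sup>\<star> * a\<^sup>\<star>"
      using x(2,5) by (metis star_mult mult.assoc)
    show "a\<^sup>\<star> = a\<^sup>\<star> * a * x"
      using x(2,4) by (metis star_mult mult.assoc)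
  qed
  ultimately show ?thesis
    using x(5) by (simp add: lh_core_invertible_iff_is_lh_inverse[OF assms] is_lh_inverse_def)
qed

lemma projection_is_core_inverse: "projection e \<Longrightarrow> is_core_inverse e e"
  by (auto simp: projection_def is_core_inverse_def power2_eq_square)

lemma projection_core_inverse:
  assumes "is_core_inverse a x"
  shows "projection (a * x)"
  using is_core_inverseD[OF assms]
  by (metis projection_def power2_eq_square mult.assoc)

lemma lh_core_invertible_projection_iff:
  assumes "is_core_inverse a x"
  shows "lh_core_invertible b c (a * x) \<longleftrightarrow> lh_core_invertible b c a"
proof -
  note x = is_core_inverseD[OF assms]
  have "left_ann (a * x) = left_ann a"
    using x(4) by (metis left_ann_eqI)
  moreover have "left_principal ((a * x)\<^sup>\<star>) = left_principal (a\<^sup>\<star>)"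
  proof (rule left_principal_eqI)
    show "(a * x)\<^sup>\<star> = x\<^sup>\<star> * a\<^sup>\<star>"
      by (rule star_mult)
    show "a\<^sup>\<star> = a\<^sup>\<star> * (a * x)\<^sup>\<star>"
      using x(4) by (metis star_mult)
  qed
  ultimately show ?thesis
    using lh_core_invertible_iff[OF assms]
      lh_core_invertible_iff[OF projection_is_core_inverse[OF projection_core_inverse[OF assms]]]
    by simp
qed

section \<open>Projections and units\<close>

lemma star_one: "(1::'a::star_ring)\<^sup>\<star> = 1"
  by (metis star_mult star_star mult_1_left mult_1_right)

lemma star_diff: "((x::'a::star_ring) - y)\<^sup>\<star> = x\<^sup>\<star> - y\<^sup>\<star>"
  by (metis star_add diff_add_cancel eq_diff_eq)

lemma projection_compl: "projection p \<Longrightarrow> projection (1 - p)"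
  by (simp add: projection_def power2_eq_square star_diff star_one algebra_simps)

lemma ring_invertible_mult:
  assumes "ring_invertible a" "ring_invertible b"
  shows "ring_invertible (a * b)"
proof -
  obtain u v where "a * u = 1" "u * a = 1" "b * v = 1" "v * b = 1"
    using assms unfolding ring_invertible_def by blast
  then have "a * b * (v * u) = 1" "v * u * (a * b) = 1"
    by (metis mult.assoc mult_1_right)+
  then show ?thesis
    unfolding ring_invertible_def by blast
qed

text \<open>Truncated geometric series: \<open>u\<close> is the sum of \<open>(-y) ^ i\<close> over
  \<open>i < n\<close>, and the remainder \<open>w * y ^ n\<close> with
  \<open>w = (-1) ^ (n + 1)\<close> dies once \<open>y ^ n = 0\<close>.\<close>

lemma ring_invertible_one_plus_nilpotent:
  fixes y :: "'a::{ring,monoid_mult}"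
  assumes "nilpotent y"
  shows "ring_invertible (1 + y)"
proof -
  have "\<exists>u w. (1 + y) * u = 1 + w * y ^ n \<and> u * (1 + y) = 1 + w * y ^ n \<and> y * w = w * y" for n
  proof (induction n)
    case 0
    have "(1 + y) * 0 = 1 + (-1) * y ^ 0 \<and> 0 * (1 + y) = 1 + (-1) * y ^ 0 \<and> y * (-1) = (-1) * y"
      by simp
    then show ?case by blast
  next
    case (Suc n)
    then obtain u w where u: "(1 + y) * u = 1 + w * y ^ n" "u * (1 + y) = 1 + w * y ^ n"
      and w: "y * w = w * y" by blast
    have yn: "y * (w * y ^ n) = w * y ^ Suc n" "w * y ^ n * y = w * y ^ Suc n"
      using w by (metis mult.assoc power_Suc power_commutes)+
    have "(1 + y) * (u - w * y ^ n) = 1 + (-w) * y ^ Suc n"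
      using u(1) yn(1) by (simp add: right_diff_distrib distrib_right)
    moreover have "(u - w * y ^ n) * (1 + y) = 1 + (-w) * y ^ Suc n"
    proof -
      have "(u - w * y ^ n) * (1 + y) = u * (1 + y) - (w * y ^ n + w * y ^ n * y)"
        by (simp only: left_diff_distrib) (simp add: distrib_left)
      then show ?thesis
        unfolding u(2) yn(2) by simp
    qed
    moreover have "y * (-w) = (-w) * y"
      using w by simp
    ultimately show ?case by blast
  qed
  then show ?thesis
    using assms unfolding nilpotent_def ring_invertible_def by (metis add_0_right mult_zero_right)
qed

text \<open>The idempotents \<open>a * x\<close> and \<open>x * a\<close> generate the same right
  ideal, so each is a left identity for the other and the cross terms cancel.\<close>

lemma core_inverse_unit:
  assumes "is_core_inverse a x"
  shows "(a + (1 - a * x)) * (x + (1 - x * a)) = 1" "(x + (1 - x * a)) * (a + (1 - a * x)) = 1"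
proof -
  note x = is_core_inverseD[OF assms]
  have "x * a * (a * x) = a * x" "a * x * (x * a) = x * a" "a * x * x = x" "x * a * a = a"
    "a * (x * a) = a" "x * (a * x) = x"
    using x by (metis mult.assoc)+
  then show "(a + (1 - a * x)) * (x + (1 - x * a)) = 1" "(x + (1 - x * a)) * (a + (1 - a * x)) = 1"
    using x by (simp_all add: distrib_left distrib_right left_diff_distrib right_diff_distrib)
qed

section \<open>Drazin invertibility\<close>

text \<open>The element \<open>z\<close> is \<open>\<Sum>i<n. g ^ (i + 1) * y ^ i\<close>, where \<open>y ^ n = 0\<close>.\<close>

lemma nilpotent_fixpoint:
  fixes g y :: "'a::{ring,monoid_mult}"
  assumes "nilpotent y" "y * g = 0"
  shows "\<exists>z. z = g + g * z * y \<and> y * z = 0"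
proof -
  \<comment> \<open>Iterate the map sending \<open>z\<close> to \<open>g + g * z * y\<close>,
    starting at 0: each round adds a factor \<open>y\<close> to the defect.\<close>
  have "\<exists>z w. z = g + g * z * y + w * y ^ n \<and> y * z = 0" for n
  proof (induction n)
    case 0
    have "0 = g + g * 0 * y + (-g) * y ^ 0 \<and> y * 0 = 0" by simp
    then show ?case by blast
  next
    case (Suc n)
    then obtain z w where z: "z = g + g * z * y + w * y ^ n" by blast
    define z' where "z' = g + g * z * y"
    have "z = z' + w * y ^ n"
      using z by (simp add: z'_def)
    then have "g * z * y = g * z' * y + g * w * y ^ Suc n"
      by (simp add: distrib_left distrib_right mult.assoc power_commutes)
    then have "z' = g + g * z' * y + g * w * y ^ Suc n"
      by (simp add: z'_def add.assoc)
    moreover have "y * z' = 0"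
      using assms(2) by (simp add: z'_def distrib_left mult.assoc[symmetric])
    ultimately show ?case by blast
  qed
  then show ?thesis
    using assms(1) unfolding nilpotent_def by (metis add_0_right mult_zero_right)
qed

text \<open>Here \<open>g\<close> is the group inverse of \<open>x\<close>. The Drazin inverse of
  \<open>x + y\<close> is the solution \<open>z\<close> of \<open>z = g + g * z * y\<close>.\<close>

lemma drazin_invertible_add_nilpotent:
  fixes x g y :: "'a::{ring,monoid_mult}"
  assumes comm: "x * g = g * x" and gxg: "g * x * g = g" and xgx: "x * g * x = x"
    and yx: "y * x = 0" and y: "nilpotent y"
  shows "drazin_invertible (x + y)"
proof -
  have "y * g = 0"
    using comm gxg yx by (metis mult.assoc mult_zero_left)
  then obtain z where z: "z = g + g * z * y" and yz: "y * z = 0"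
    using nilpotent_fixpoint[OF y] by blast
  have gxz: "g * x * z = z"
    using z gxg by (metis distrib_left mult.assoc)
  have "x * z = x * g + x * g * z * y"
    using z by (metis distrib_left mult.assoc)
  then have az: "(x + y) * z = x * g + z * y"
    using comm gxz yz by (simp add: distrib_right)
  \<comment> \<open>The part of \<open>z\<close> beyond \<open>g\<close> ends in \<open>y\<close>,
    which annihilates \<open>x\<close> from the left.\<close>
  have "z * x = g * x"
    using z yx by (metis distrib_right mult.assoc mult_zero_right add_0_right)
  then have za: "z * (x + y) = x * g + z * y"
    using comm by (simp add: distrib_left)
  have zaz: "z * (x + y) * z = z"
    using comm gxz yz za by (simp add: distrib_right mult.assoc)
  \<comment> \<open>The complementary idempotent \<open>q\<close> kills \<open>x\<close>, so under
    \<open>q\<close> the powers of \<open>x + y\<close> reduce to those of \<open>y\<close> and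
    eventually vanish; this bounds the Drazin index.\<close>
  define q where "q = 1 - z * (x + y)"
  have qx: "q * x = 0"
    unfolding q_def za using xgx yx by (simp add: left_diff_distrib distrib_right mult.assoc)
  have qk: "q * (x + y) ^ k = q * y ^ k" for k
  proof (induction k)
    case (Suc k)
    \<comment> \<open>For \<open>k = 0\<close> this is \<open>q * x = 0\<close>; otherwise the last
      factor \<open>y\<close> kills \<open>x\<close>.\<close>
    have "q * y ^ k * x = 0"
      using qx yx by (cases k) (simp_all add: power_Suc2 mult.assoc del: power_Suc)
    have "q * (x + y) ^ Suc k = q * (x + y) ^ k * (x + y)"
      by (simp add: power_Suc2 mult.assoc del: power_Suc)
    also have "\<dots> = q * y ^ k * y"
      using Suc \<open>q * y ^ k * x = 0\<close> by (simp add: distrib_left)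
    finally show ?case
      by (simp add: power_Suc2 mult.assoc del: power_Suc)
  qed simp
  obtain n where "y ^ n = 0"
    using y unfolding nilpotent_def by blast
  then have "q * (x + y) ^ n = 0"
    using qk by simp
  then have "z * (x + y) ^ (n + 1) = (x + y) ^ n"
    by (simp add: q_def left_diff_distrib mult.assoc)
  moreover have "z * (x + y) ^ (n + 1) = (x + y) ^ (n + 1) * z"
    using az za by (metis power_commuting_commutes)
  ultimately show ?thesis
    unfolding drazin_invertible_def using az za zaz by metis
qed

text \<open>A core invertible element is group invertible, with group inverse
  \<open>x * x * a\<close>; this supplies the \<open>g\<close> of the Drazin criterion.\<close>

lemma core_inverse_group_inverse:
  assumes "is_core_inverse a x"
  shows "a * (x * x * a) = x * x * a * a" "x * x * a * a * (x * x * a) = x * x * a"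
    "a * (x * x * a) * a = a"
  using is_core_inverseD[OF assms] by (metis mult.assoc)+

section \<open>Core-EP decompositions and their projections\<close>

lemma core_EP_decomposition_imp_projection:
  fixes x y :: "'a::star_ring"
  assumes x': "is_core_inverse x x'" and orth: "x\<^sup>\<star> * y = 0" "y * x = 0" and y: "nilpotent y"
  defines "p \<equiv> 1 - x * x'"
  shows "projection p" "ring_invertible (x + y + p)" "p * (x + y) = y" "y * p = y"
proof -
  note c = is_core_inverseD[OF x']
  show "projection p"
    unfolding p_def by (intro projection_compl projection_core_inverse x')
  \<comment> \<open>Self-adjointness gives
    \<open>x * x' = x'\<^sup>\<star> * x\<^sup>\<star>\<close>, whose right factor kills
    \<open>y\<close>.\<close>
  have "x * x' * y = 0"
    using c(2) orth(1) by (metis star_mult mult.assoc mult_zero_right)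
  then show "p * (x + y) = y"
    using c(4) by (simp add: p_def left_diff_distrib distrib_left)
  show "y * p = y"
    using orth(2) by (simp add: p_def right_diff_distrib mult.assoc[symmetric])
  have "y * x' = 0"
    using c(1) orth(2) by (metis mult.assoc mult_zero_left)
  have "ring_invertible (x + p)"
    using core_inverse_unit[OF x'] unfolding ring_invertible_def p_def by blast
  then have "ring_invertible ((1 + y) * (x + p))"
    using y by (intro ring_invertible_mult ring_invertible_one_plus_nilpotent)
  also have "(1 + y) * (x + p) = x + y + p"
    using orth(2) \<open>y * p = y\<close> by (simp add: distrib_left distrib_right algebra_simps)
  finally show "ring_invertible (x + y + p)" .
qed

lemma is_core_inverse_corner:
  fixes a p u :: "'a::star_ring"
  assumes p: "projection p" and u: "(a + p) * u = 1" "u * (a + p) = 1"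
    and pap: "p * a = p * a * p" and nil: "nilpotent (p * a)"
  shows "is_core_inverse ((1 - p) * a) (u * (1 - p))" "(1 - p) * a * (u * (1 - p)) = 1 - p"
proof -
  define e where "e = 1 - p"
  have pp: "p * p = p"
    using p by (simp add: projection_def power2_eq_square)
  have pe: "p * e = 0" "e * p = 0" "e * e = e" "e\<^sup>\<star> = e"
    using p pp unfolding e_def projection_def
    by (simp_all add: left_diff_distrib right_diff_distrib star_diff star_one)
  have pae: "p * a * e = 0"
    using pap by (simp add: e_def right_diff_distrib)
  \<comment> \<open>Multiplying by \<open>u * e\<close> turns this into
    \<open>(1 + p * a) * (p * u * e) = 0\<close>. Since \<open>1 + p * a\<close> is a unit,
    \<open>p * u * e = 0\<close>: the inverse \<open>u\<close> is upper triangular too.\<close>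
  have "p * (a + p) = (1 + p * a) * p"
    using pap pp by (simp add: distrib_left distrib_right)
  then have "(1 + p * a) * (p * u) = p"
    using u(1) by (metis mult.assoc mult_1_right)
  then have "(1 + p * a) * (p * u * e) = 0"
    using pe(1) by (metis mult.assoc)
  then have pue: "p * (u * e) = 0"
    using ring_invertible_one_plus_nilpotent[OF nil] unfolding ring_invertible_def
    by (metis mult.assoc mult_1_left mult_zero_right)
  have "a * (u * e) = e"
    using u(1) pue by (metis mult.assoc mult_1_left distrib_right add_0_right)
  then show xX: "(1 - p) * a * (u * (1 - p)) = 1 - p"
    using pe(3) by (simp add: e_def[symmetric] mult.assoc)
  have "e * (u * e) = u * e"
    using pue by (simp add: e_def left_diff_distrib)
  then have "e * a * (u * e) ^ 2 = u * e"
    using xX by (simp add: e_def[symmetric] power2_eq_square mult.assoc[symmetric])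
  \<comment> \<open>The corner \<open>e * a * e\<close> is the first column of the triangular
    \<open>a + p\<close>, so \<open>u\<close> inverts it from the left.\<close>
  have "e * (a * e) = (a + p) * e"
    using pae pe(1) by (simp add: e_def left_diff_distrib distrib_right mult.assoc)
  then have "u * (e * (a * e)) = e"
    using u(2) by (metis mult.assoc mult_1_left)
  then have "u * e * (e * a) ^ 2 = e * a"
    using pe(3) by (metis power2_eq_square mult.assoc)
  with xX \<open>e * a * (u * e) ^ 2 = u * e\<close> pe(4)
  show "is_core_inverse ((1 - p) * a) (u * (1 - p))"
    unfolding is_core_inverse_def by (simp add: e_def[symmetric])
qed

theorem theorem4p3:
  fixes a b c :: "'a::star_ring"
  shows "lh_core_EP_invertible b c a \<longleftrightarrow>
    drazin_invertible a \<and>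
    (\<exists>p. projection p \<and> ring_invertible (a + p) \<and> lh_core_invertible b c (1 - p) \<and>
         p * a = p * a * p \<and> nilpotent (p * a))"
proof
  assume "lh_core_EP_invertible b c a"
  then obtain x y where a: "a = x + y" and orth: "x\<^sup>\<star> * y = 0" "y * x = 0"
    and x: "lh_core_invertible b c x" and y: "nilpotent y"
    unfolding lh_core_EP_invertible_def by blast
  obtain x' where x': "is_core_inverse x x'"
    using x unfolding lh_core_invertible_def core_invertible_def by blast
  have "drazin_invertible a"
    unfolding a using core_inverse_group_inverse[OF x'] orth(2) y
    by (rule drazin_invertible_add_nilpotent)
  moreover have "lh_core_invertible b c (1 - (1 - x * x'))"
    using x lh_core_invertible_projection_iff[OF x'] by simp
  ultimately show "drazin_invertible a \<and>
    (\<exists>p. projection p \<and> ring_invertible (a + p) \<and> lh_core_invertible b c (1 - p) \<and>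
         p * a = p * a * p \<and> nilpotent (p * a))"
    using core_EP_decomposition_imp_projection[OF x' orth y] y unfolding a by metis
next
  assume "drazin_invertible a \<and>
    (\<exists>p. projection p \<and> ring_invertible (a + p) \<and> lh_core_invertible b c (1 - p) \<and>
         p * a = p * a * p \<and> nilpotent (p * a))"
  then obtain p u where p: "projection p" and u: "(a + p) * u = 1" "u * (a + p) = 1"
    and lh: "lh_core_invertible b c (1 - p)"
    and pap: "p * a = p * a * p" and nil: "nilpotent (p * a)"
    unfolding ring_invertible_def by blast
  note corner = is_core_inverse_corner[OF p u pap nil]
  have "a = (1 - p) * a + p * a"
    by (simp add: left_diff_distrib)
  moreover have "((1 - p) * a)\<^sup>\<star> * (p * a) = 0"
  proof -
    have "(1 - p)\<^sup>\<star> * p = 0"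
      using p by (simp add: projection_def power2_eq_square star_diff star_one left_diff_distrib)
    then show ?thesis
      by (metis star_mult mult.assoc mult_zero_left mult_zero_right)
  qed
  moreover have "p * a * ((1 - p) * a) = 0"
  proof -
    have "p * a * (1 - p) = 0"
      using pap by (simp add: right_diff_distrib)
    then show ?thesis
      by (metis mult.assoc mult_zero_left)
  qed
  \<comment> \<open>By \<open>corner(2)\<close>, \<open>1 - p\<close> is the product of
    \<open>(1 - p) * a\<close> with its core inverse, so the hybrid property passes from one to the
    other.\<close>
  moreover have "lh_core_invertible b c ((1 - p) * a)"
    using lh lh_core_invertible_projection_iff[OF corner(1)] corner(2) by simp
  ultimately show "lh_core_EP_invertible b c a"
    using nil unfolding lh_core_EP_invertible_def by blast
qed

end
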